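(* Let $\mathsf{x}^*=(x_1^*,\dots,x_n^* )^T\in\mathbb{R}^n$, $\mathcal{J}=\mathrm{supp}(\mathsf{x}^* )$ and $\mathcal{J}^c=\{1,\dots,n\}\setminus\mathcal{J}$. Assume that there exists a vector $\mathbf{c}\in\mathbb{R}^n$ such that $$\frac{\mathsf{P}\mathbf{e}_i}{\|\mathsf{P}\mathbf{e}_i\|_2}\cdot\mathbf{c}=\mathrm{sgn}(x_i^* )\quad\forall i\in\mathcal{J},\qquad \left|\frac{\mathsf{P}\mathbf{e}_i}{\|\mathsf{P}\mathbf{e}_i\|_2}\cdot\mathbf{c}\right|<1\quad\forall i\in\mathcal{J}^c .$$ Then any solution $\mathbf{y}$ of $$\min_{\mathbf{x}\in\mathbb{R}^n}\|\mathsf{W}\mathbf{x}\|_1\quad\text{subject to}\quad\mathsf{A}\mathbf{x}=\mathsf{A}\mathsf{x}^*$$ obeys $$\mathrm{sgn}(y_k)\in\{0,\mathrm{sgn}(x_k^* )\}\quad\forall k\in\{1,2,\dots,n\}.$$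
   Context: $\mathsf{A}\in\mathbb{R}^{m\times n}$ is a matrix with nontrivial null space $\mathcal{N}(\mathsf{A})$, $\mathsf{A}^\dagger$ is its Moore-Penrose pseudo-inverse, and $\mathsf{P}=\mathsf{A}^\dagger\mathsf{A}$ is the orthogonal projection of $\mathbb{R}^n$ onto $\mathcal{N}(\mathsf{A})^\perp$. $\mathbf{e}_1,\dots,\mathbf{e}_n$ are the standard basis vectors of $\mathbb{R}^n$, and it is assumed that $\mathsf{P}\mathbf{e}_i\neq 0$ for all $i$. $\mathsf{W}\in\mathbb{R}^{n\times n}$ is the diagonal matrix defined by $\mathsf{W}\mathbf{e}_i=\|\mathsf{P}\mathbf{e}_i\|_2\,\mathbf{e}_i$. $\mathrm{supp}(\mathbf{v})=\{i: v_i\neq 0\}$, and $\mathrm{sgn}(0)=0$. A solution of a minimization problem means a global minimizer. *)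

theory Defs
  imports "HOL-Analysis.Analysis"
begin

definition is_pseudo_inverse :: "real^'n^'m \<Rightarrow> real^'m^'n \<Rightarrow> bool" where
  "is_pseudo_inverse A X \<longleftrightarrow>
     A ** X ** A = A \<and> X ** A ** X = X \<and>
     transpose (A ** X) = A ** X \<and> transpose (X ** A) = X ** A"

definition pseudo_inverse :: "real^'n^'m \<Rightarrow> real^'m^'n" where
  "pseudo_inverse A = (THE X. is_pseudo_inverse A X)"

lemma is_pseudo_inverse_unique:
  fixes A :: "real^'n^'m"
  assumes "is_pseudo_inverse A X" and "is_pseudo_inverse A Y"
  shows "X = Y"
proof -
  have 1: "(A ** X) = (A ** Y)"
  proof -
    have "A ** X = (A ** Y) ** (A ** X)"
      using assms(2) unfolding is_pseudo_inverse_def by (metis matrix_mul_assoc)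
    then have "transpose (A ** X) = transpose (A ** X) ** transpose (A ** Y)"
      by (metis matrix_transpose_mul)
    then have "A ** X = (A ** X) ** (A ** Y)"
      using assms unfolding is_pseudo_inverse_def by metis
    then show ?thesis
      using assms(1) unfolding is_pseudo_inverse_def by (metis matrix_mul_assoc)
  qed
  have 2: "X ** A = Y ** A"
  proof -
    have "X ** A = (X ** A) ** (Y ** A)"
      using assms(2) unfolding is_pseudo_inverse_def by (metis matrix_mul_assoc)
    then have "transpose (X ** A) = transpose (Y ** A) ** transpose (X ** A)"
      by (metis matrix_transpose_mul)
    then have "X ** A = (Y ** A) ** (X ** A)"
      using assms unfolding is_pseudo_inverse_def by metis
    then show ?thesis
      using assms(1) unfolding is_pseudo_inverse_def by (metis matrix_mul_assoc)
  qed
  have "X = X ** A ** X" using assms(1) unfolding is_pseudo_inverse_def by simp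
  also have "\<dots> = Y ** A ** Y" using 1 2 by (metis matrix_mul_assoc)
  also have "\<dots> = Y" using assms(2) unfolding is_pseudo_inverse_def by simp
  finally show ?thesis .
qed

lemma projection_matrix_exists:
  fixes S :: "(real^'n) set"
  assumes "subspace S"
  obtains Q :: "real^'n^'n" where "transpose Q = Q"
    and "\<And>x. Q *v x \<in> S" and "\<And>x. x \<in> S \<Longrightarrow> Q *v x = x"
proof -
  obtain B where B: "B \<subseteq> S" "pairwise orthogonal B" "\<And>x. x \<in> B \<Longrightarrow> norm x = 1"
      "independent B" "span B = S"
    using orthonormal_basis_subspace[OF assms] by metis
  have fin: "finite B" using B(4) independent_imp_finite by blast
  define q where "q = (\<lambda>x::real^'n. \<Sum>b\<in>B. (x \<bullet> b) *\<^sub>R b)"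
  have lin: "linear q"
    unfolding q_def
    by (intro linearI) (simp_all add: inner_left_distrib scaleR_left_distrib sum.distrib scaleR_sum_right)
  have Qv: "matrix q *v x = q x" for x
    using lin by (simp add: matrix_works)
  have inS: "q x \<in> S" for x
    unfolding q_def using B(1) assms by (intro subspace_sum subspace_scale) auto
  have sym: "q x \<bullet> y = x \<bullet> q y" for x y
    unfolding q_def by (simp add: inner_sum_left inner_sum_right mult.commute inner_commute)
  have qb: "q b = b" if "b \<in> B" for b
  proof -
    have "q b = (\<Sum>c\<in>B. if c = b then b else 0)"
      unfolding q_def
    proof (rule sum.cong)
      fix c assume "c \<in> B"
      then show "(b \<bullet> c) *\<^sub>R c = (if c = b then b else 0)"
        using B(2,3) that by (auto simp: pairwise_def orthogonal_def norm_eq_1)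
    qed simp
    then show ?thesis using that fin by simp
  qed
  have id: "q x = x" if "x \<in> S" for x
  proof -
    have "x \<in> span B" using that B(5) by simp
    then show ?thesis
      using linear_eq_on[OF lin linear_ident, of x B] qb by simp
  qed
  have "transpose (matrix q) *v x = matrix q *v x" for x
  proof -
    have "(transpose (matrix q) *v x) \<bullet> y = (matrix q *v x) \<bullet> y" for y
      by (metis Qv sym dot_lmul_matrix transpose_matrix_vector)
    then show ?thesis by (metis vector_eq_rdot)
  qed
  then have "transpose (matrix q) = matrix q" by (simp add: matrix_eq)
  with that show thesis using Qv inS id by metis
qed

lemma is_pseudo_inverse_exists:
  fixes A :: "real^'n^'m"
  shows "\<exists>X. is_pseudo_inverse A X"
proof -
  define N where "N = {x. A *v x = 0}"
  define V where "V = {x. \<forall>z\<in>N. x \<bullet> z = 0}"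
  have sN: "subspace N"
    unfolding N_def subspace_def
    by (auto simp: matrix_vector_right_distrib matrix_vector_mult_scaleR)
  have sV: "subspace V"
    unfolding V_def subspace_def by (auto simp: inner_left_distrib)
  have sR: "subspace (range ((*v) A))"
    using linear_subspace_image[OF matrix_vector_mul_linear subspace_UNIV] .
  obtain QN :: "real^'n^'n" where QN: "transpose QN = QN"
      "\<And>x. QN *v x \<in> N" "\<And>x. x \<in> N \<Longrightarrow> QN *v x = x"
    using projection_matrix_exists[OF sN] by metis
  obtain QR :: "real^'m^'m" where QR: "transpose QR = QR"
      "\<And>x. QR *v x \<in> range ((*v) A)" "\<And>x. x \<in> range ((*v) A) \<Longrightarrow> QR *v x = x"
    using projection_matrix_exists[OF sR] by metis
  have symN: "(QN *v x) \<bullet> y = x \<bullet> (QN *v y)" for x y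
    by (metis QN(1) dot_lmul_matrix transpose_matrix_vector)
  have inV: "x - QN *v x \<in> V" for x
    unfolding V_def using symN QN(3) by (auto simp: inner_diff_left)
  have QN0: "QN *v v = 0" if "v \<in> V" for v
  proof -
    have "(QN *v v) \<bullet> (QN *v v) = v \<bullet> (QN *v (QN *v v))" by (rule symN)
    also have "\<dots> = 0" using that QN(2,3) unfolding V_def by auto
    finally show ?thesis by simp
  qed
  have "inj_on ((*v) A) V"
  proof (rule inj_onI)
    fix x y assume "x \<in> V" "y \<in> V" "A *v x = A *v y"
    then have "x - y \<in> V" "x - y \<in> N"
      using sV by (auto simp: subspace_diff N_def matrix_vector_mult_diff_distrib)
    then have "(x - y) \<bullet> (x - y) = 0" unfolding V_def by blast
    then show "x = y" by simp
  qed
  then obtain g where g: "range g \<subseteq> V" "linear g" "\<And>v. v \<in> V \<Longrightarrow> g (A *v v) = v"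
    using linear_exists_left_inverse_on[OF matrix_vector_mul_linear sV] by metis
  define X where "X = matrix g ** QR"
  have Xv: "X *v y = g (QR *v y)" for y
    unfolding X_def using g(2) by (simp add: matrix_works flip: matrix_vector_mul_assoc)
  have Aproj: "A *v (x - QN *v x) = A *v x" for x
    using QN(2)[of x] by (simp add: N_def matrix_vector_mult_diff_distrib)
  have gA: "g (A *v x) = x - QN *v x" for x
    using g(3)[OF inV[of x]] Aproj by simp
  have XA: "X *v (A *v x) = x - QN *v x" for x
    using Xv QR(3) gA by simp
  have AX: "A *v (X *v y) = QR *v y" for y
  proof -
    obtain x where x: "QR *v y = A *v x" using QR(2)[of y] by blast
    then show ?thesis by (simp add: Xv gA Aproj)
  qed
  have XA': "X ** A = mat 1 - QN"
    by (simp add: matrix_eq XA matrix_vector_mult_diff_rdistrib flip: matrix_vector_mul_assoc)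
  have AX': "A ** X = QR"
    by (simp add: matrix_eq AX flip: matrix_vector_mul_assoc)
  have "transpose (X ** A) = X ** A"
    using QN(1) unfolding XA' by (simp add: transpose_def mat_def vec_eq_iff)
  moreover have "transpose (A ** X) = A ** X" using AX' QR(1) by simp
  moreover have "A ** X ** A = A"
    using QR(3) by (simp add: AX' matrix_eq flip: matrix_vector_mul_assoc)
  moreover have "X ** A ** X = X"
  proof -
    have "X *v (A *v (X *v y)) = X *v y" for y
      using QN0[of "X *v y"] g(1) XA[of "X *v y"] Xv[of y] by auto
    then show ?thesis by (simp add: matrix_eq flip: matrix_vector_mul_assoc)
  qed
  ultimately show ?thesis unfolding is_pseudo_inverse_def by blast
qed

lemma pseudo_inverse: "is_pseudo_inverse A (pseudo_inverse A)"
  unfolding pseudo_inverse_def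
  using is_pseudo_inverse_exists is_pseudo_inverse_unique by (metis theI)

definition row_projection :: "real^'n^'m \<Rightarrow> real^'n^'n" where
  "row_projection A = pseudo_inverse A ** A"

lemma row_projection_orthogonal:
  fixes A :: "real^'n^'m"
  shows "A *v (x - row_projection A *v x) = 0"
    and "A *v z = 0 \<Longrightarrow> (row_projection A *v x) \<bullet> z = 0"
proof -
  have P: "A ** row_projection A = A" "transpose (row_projection A) = row_projection A"
    using pseudo_inverse[of A]
    by (auto simp: is_pseudo_inverse_def row_projection_def matrix_mul_assoc)
  show "A *v (x - row_projection A *v x) = 0"
    by (simp add: matrix_vector_mult_diff_distrib matrix_vector_mul_assoc P)
  assume "A *v z = 0"
  then have "row_projection A *v z = 0"
    by (simp add: row_projection_def flip: matrix_vector_mul_assoc)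
  then show "(row_projection A *v x) \<bullet> z = 0"
    by (metis P(2) dot_lmul_matrix transpose_matrix_vector inner_zero_right)
qed

definition weight_matrix :: "real^'n^'m \<Rightarrow> real^'n^'n" where
  "weight_matrix A =
     (\<chi> i j. if i = j then norm (row_projection A *v axis i 1) else 0)"

lemma weight_matrix_axis:
  "weight_matrix A *v axis i 1 = norm (row_projection A *v axis i 1) *\<^sub>R axis i 1"
  by (simp add: weight_matrix_def vec_eq_iff matrix_vector_mult_basis column_def)
    (simp add: axis_def)

text \<open>The library \<^const>\<open>norm\<close> on \<open>real^'n\<close> is the Euclidean norm.\<close>
definition l1_norm :: "real^'n \<Rightarrow> real" where
  "l1_norm x = (\<Sum>i\<in>UNIV. \<bar>x $ i\<bar>)"

definition supp :: "real^'n \<Rightarrow> 'n set" where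
  "supp v = {i. v $ i \<noteq> 0}"

end

theory Submission
  imports Defs
begin

text \<open>
  The vector \<open>c\<close> is a dual certificate. With \<open>w\<^sub>i = \<parallel>P e\<^sub>i\<parallel>\<close> and \<open>u\<^sub>i = (P e\<^sub>i / w\<^sub>i) \<bullet> c\<close>,
  the linear functional \<open>x \<mapsto> (P x) \<bullet> c\<close> has the coordinate expansion
  \<open>\<Sum>i. w\<^sub>i u\<^sub>i x\<^sub>i\<close> (lemma \<open>row_projection_inner_expansion\<close>). It is constant on the feasible
  set, since \<open>P x\<close> depends on \<open>x\<close> only through \<open>A x\<close> (lemma \<open>row_projection_cong\<close>). Since every
  \<open>\<bar>u\<^sub>i\<bar> \<le> 1\<close>, it is a lower bound for the weighted norm \<open>\<Sum>i. w\<^sub>i \<bar>x\<^sub>i\<bar>\<close>, and at \<open>x\<^sup>*\<close> the two agree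
  because \<open>u\<^sub>i\<close> is the sign of \<open>x\<^sup>*\<^sub>i\<close> on the support. So \<open>x\<^sup>*\<close> is optimal, and at any other minimizer
  \<open>y\<close> the bound must be attained as well. As the weights are positive, it is attained coordinate
  by coordinate: \<open>u\<^sub>i y\<^sub>i = \<bar>y\<^sub>i\<bar>\<close> (lemma \<open>weighted_duality_tight\<close>). On the support of \<open>x\<^sup>*\<close>
  this prevents \<open>y\<^sub>i\<close> from having the opposite sign; off the support, where \<open>\<bar>u\<^sub>i\<bar> < 1\<close>, it forces
  \<open>y\<^sub>i = 0\<close>.
\<close>

lemma row_projection_cong:
  fixes A :: "real^'n^'m"
  assumes "A *v x = A *v z"
  shows "row_projection A *v x = row_projection A *v z"
  using assms by (simp add: row_projection_def flip: matrix_vector_mul_assoc)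

lemma row_projection_inner_expansion:
  fixes A :: "real^'n^'m"
  shows "(row_projection A *v x) \<bullet> c =
    (\<Sum>i\<in>UNIV. x $ i * ((row_projection A *v axis i 1) \<bullet> c))"
  by (simp add: matrix_mult_sum[of "row_projection A" x] matrix_vector_mult_basis
      inner_sum_left scalar_mult_eq_scaleR)

lemma l1_norm_weight_matrix:
  fixes A :: "real^'n^'m"
  shows "l1_norm (weight_matrix A *v x) =
    (\<Sum>i\<in>UNIV. norm (row_projection A *v axis i 1) * \<bar>x $ i\<bar>)"
proof -
  have "(weight_matrix A *v x) $ i = norm (row_projection A *v axis i 1) * x $ i" for i
    by (simp add: weight_matrix_def matrix_vector_mult_def if_distrib[of "\<lambda>t. t * _"]
        cong: if_cong)
  then show ?thesis
    by (simp add: l1_norm_def abs_mult)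
qed

text \<open>
  The equality case of the duality between the weighted \<open>\<ell>\<^sub>1\<close> and \<open>\<ell>\<^sub>\<infinity>\<close> norms. Each gap
  \<open>w i * (\<bar>y i\<bar> - u i * y i)\<close> is nonnegative, so if their sum is not positive, all of them vanish.
\<close>

lemma weighted_duality_tight:
  fixes w u y :: "'a \<Rightarrow> real"
  assumes "finite I"
    and w: "\<And>i. i \<in> I \<Longrightarrow> 0 < w i"
    and u: "\<And>i. i \<in> I \<Longrightarrow> \<bar>u i\<bar> \<le> 1"
    and le: "(\<Sum>i\<in>I. w i * \<bar>y i\<bar>) \<le> (\<Sum>i\<in>I. w i * (u i * y i))"
    and "k \<in> I"
  shows "u k * y k = \<bar>y k\<bar>"
proof -
  define gap where "gap i = w i * (\<bar>y i\<bar> - u i * y i)" for i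
  have nonneg: "0 \<le> gap i" if "i \<in> I" for i
  proof -
    have "u i * y i \<le> \<bar>u i\<bar> * \<bar>y i\<bar>"
      by (metis abs_ge_self abs_mult)
    also have "\<dots> \<le> 1 * \<bar>y i\<bar>"
      using u[OF that] by (intro mult_right_mono) auto
    finally show ?thesis
      using w[OF that] by (simp add: gap_def)
  qed
  have "sum gap I \<le> 0"
    using le by (simp add: gap_def right_diff_distrib sum_subtractf)
  then have "sum gap I = 0"
    using nonneg by (meson antisym sum_nonneg)
  then have "gap k = 0"
    using sum_nonneg_eq_0_iff[of I gap] nonneg assms(1) \<open>k \<in> I\<close> by blast
  then show ?thesis
    using w[OF \<open>k \<in> I\<close>] by (simp add: gap_def)
qed

theorem theorem4p3:
  fixes A :: "real^'n^'m" and xs y :: "real^'n"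
  assumes "\<exists>v. v \<noteq> 0 \<and> A *v v = 0"
    and "\<And>i. row_projection A *v axis i 1 \<noteq> 0"
    and "\<exists>c :: real^'n.
      (\<forall>i \<in> supp xs.
         ((row_projection A *v axis i 1) /\<^sub>R norm (row_projection A *v axis i 1)) \<bullet> c
           = sgn (xs $ i)) \<and>
      (\<forall>i \<in> - supp xs.
         \<bar>((row_projection A *v axis i 1) /\<^sub>R norm (row_projection A *v axis i 1)) \<bullet> c\<bar> < 1)"
    and "is_arg_min (\<lambda>x. l1_norm (weight_matrix A *v x)) (\<lambda>x. A *v x = A *v xs) y"
  shows "\<forall>k. sgn (y $ k) \<in> {0, sgn (xs $ k)}"
proof
  fix k
  define w where "w i = norm (row_projection A *v axis i 1)" for i
  obtain c where
      on_supp: "\<And>i. i \<in> supp xs \<Longrightarrow> ((row_projection A *v axis i 1) /\<^sub>R w i) \<bullet> c = sgn (xs $ i)"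
    and off_supp: "\<And>i. i \<notin> supp xs \<Longrightarrow> \<bar>((row_projection A *v axis i 1) /\<^sub>R w i) \<bullet> c\<bar> < 1"
    using assms(3) unfolding w_def by (metis ComplI)
  define u where "u i = ((row_projection A *v axis i 1) /\<^sub>R w i) \<bullet> c" for i
  have w_pos: "0 < w i" for i
    using assms(2) by (simp add: w_def)
  have u_on: "u i = sgn (xs $ i)" if "xs $ i \<noteq> 0" for i
    using on_supp[of i] that by (simp add: u_def supp_def)
  have u_off: "\<bar>u i\<bar> < 1" if "xs $ i = 0" for i
    using off_supp[of i] that by (simp add: u_def supp_def)
  have u_le: "\<bar>u i\<bar> \<le> 1" for i
    using u_on[of i] u_off[of i] by (cases "xs $ i = 0") (auto simp: abs_sgn_eq)
  have functional: "(row_projection A *v x) \<bullet> c = (\<Sum>i\<in>UNIV. w i * (u i * x $ i))" for x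
  proof (subst row_projection_inner_expansion, rule sum.cong)
    fix i
    show "x $ i * ((row_projection A *v axis i 1) \<bullet> c) = w i * (u i * x $ i)"
      using w_pos[of i] by (simp add: u_def)
  qed simp
  have feasible: "A *v y = A *v xs"
    and minimal: "l1_norm (weight_matrix A *v y) \<le> l1_norm (weight_matrix A *v xs)"
    using assms(4) by (auto simp: is_arg_min_linorder)
  have "(\<Sum>i\<in>UNIV. w i * \<bar>y $ i\<bar>) \<le> (\<Sum>i\<in>UNIV. w i * \<bar>xs $ i\<bar>)"
    using minimal by (simp add: l1_norm_weight_matrix w_def)
  also have "\<dots> = (\<Sum>i\<in>UNIV. w i * (u i * xs $ i))"
  proof (rule sum.cong)
    fix i
    show "w i * \<bar>xs $ i\<bar> = w i * (u i * xs $ i)"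
      using u_on[of i] by (cases "xs $ i = 0") (auto simp: abs_sgn mult.commute)
  qed simp
  also have "\<dots> = (\<Sum>i\<in>UNIV. w i * (u i * y $ i))"
    using row_projection_cong[OF feasible] by (simp flip: functional)
  finally have tight: "u k * y $ k = \<bar>y $ k\<bar>"
    using weighted_duality_tight[of UNIV w u "($) y" k] w_pos u_le by simp
  show "sgn (y $ k) \<in> {0, sgn (xs $ k)}"
  proof (cases "xs $ k = 0")
    case True
    have "y $ k = 0"
    proof (rule ccontr)
      assume "y $ k \<noteq> 0"
      have "\<bar>u k\<bar> * \<bar>y $ k\<bar> = 1 * \<bar>y $ k\<bar>"
        using arg_cong[OF tight, of abs] by (simp add: abs_mult)
      then have "\<bar>u k\<bar> = 1"
        using \<open>y $ k \<noteq> 0\<close> by simp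
      then show False
        using u_off[OF True] by simp
    qed
    then show ?thesis
      by simp
  next
    case False
    then show ?thesis
      using tight u_on[OF False] by (auto simp: sgn_if split: if_splits)
  qed
qed

end
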